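(* Let $V\subset X$ be a $p$-dimensional subspace, $n=\dim X$, and let $W_I$, $I\in\mathcal I_p^n$, be the coordinate $p$-subspaces of an orthogonal basis of $X$. Then $$\sum_{I\in\mathcal I_p^n} \cos^2\Theta_{V,W_I} = 1.$$
   Context: $X$ is an $n$-dimensional vector space over $\mathbb{R}$ (real case) or $\mathbb{C}$ (complex case) with inner product $\langle\cdot,\cdot\rangle$ (Hermitian in the complex case, conjugate-linear in the first argument). Blades: a $p$-blade is a simple multivector $\nu=v_1\wedge\cdots\wedge v_p\in\Lambda^pX$; if $\nu\neq0$ it represents the $p$-dimensional subspace $V=\mathrm{span}(v_1,\ldots,v_p)$. Nonzero scalars in $\Lambda^0X$ are $0$-blades representing $\{0\}$. $\Lambda X$ has the inner product given on $p$-blades by $\langle v_1\wedge\cdots\wedge v_p,\,w_1\wedge\cdots\wedge w_p\rangle=\det(\langle v_i,w_j\rangle)$, extended (sesqui)linearly, with distinct grades orthogonal; $\|\nu\|=\sqrt{\langle\nu,\nu\rangle}$. Grassmann angle: for subspaces $V,W\subset X$, let $P$ be the orthogonal projection of $X$ onto $W$, acting on blades by $P(v_1\wedge\cdots\wedge v_p)=Pv_1\wedge\cdots\wedge Pv_p$ (identity on scalars). The Grassmann angle $\Theta_{V,W}\in[0,\frac\pi2]$ is defined by $\cos\Theta_{V,W}=\|P\nu\|/\|\nu\|$ for any nonzero blade $\nu$ representing $V$ (independent of $\nu$). Multi-indices and coordinate subspaces: for $1\le p\le q$, $\mathcal I_p^q=\{(i_1,\ldots,i_p)\in\mathbb N^p:1\le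 i_1<\cdots<i_p\le q\}$, and $\mathcal I_0^q=\{0\}$ (a single index). Given a basis $(w_1,\ldots,w_q)$ of a subspace, its coordinate $p$-subspaces are $W_I=\mathrm{span}(w_{i_1},\ldots,w_{i_p})$ for $I=(i_1,\ldots,i_p)\in\mathcal I_p^q$; for $p=0$, $W_I=\{0\}$. *)

theory Defs
  imports
    "HOL-Library.Poly_Mapping"
    "Jordan_Normal_Form.Conjugate"
    "Jordan_Normal_Form.Determinant"
begin

text \<open>
  The scalar field is either the reals (with trivial conjugation) or the complex numbers.
  The axiom below makes \<open>a + conjugate a\<close> real as well (expand it at \<open>1 + a\<close>), so every element
  has degree at most two over the reals and, up to isometric isomorphism, there are no other
  instances than the two given here.
\<close>

class real_or_complex = real_normed_field + conjugatable_field +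
  assumes mult_conjugate_norm: "a * conjugate a = ((norm a)\<^sup>2) *\<^sub>R 1"

instance real :: real_or_complex
  by standard (simp add: power2_eq_square)

instance complex :: real_or_complex
  by standard (simp only: conjugate_complex_def complex_norm_square[symmetric] of_real_def)

locale fin_dim_inner_space = vector_space scale
  for scale :: "'k::real_or_complex \<Rightarrow> 'v::ab_group_add \<Rightarrow> 'v" (infixr \<open>*s\<close> 75) +
  fixes ip :: "'v \<Rightarrow> 'v \<Rightarrow> 'k"
  assumes ip_add_right: "ip x (y + z) = ip x y + ip x z"
    and ip_scale_right: "ip x (c *s y) = c * ip x y"
    and ip_conjugate: "ip y x = conjugate (ip x y)"
    and ip_pos: "x \<noteq> 0 \<Longrightarrow> \<exists>r::real. r > 0 \<and> ip x x = of_real r"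
    and fin_dim: "\<exists>B. finite B \<and> span B = UNIV"
begin

definition orthogonal_basis :: "nat \<Rightarrow> (nat \<Rightarrow> 'v) \<Rightarrow> bool" where
  "orthogonal_basis n w \<longleftrightarrow>
     inj_on w {1..n} \<and> independent (w ` {1..n}) \<and> span (w ` {1..n}) = UNIV \<and>
     (\<forall>i\<in>{1..n}. \<forall>j\<in>{1..n}. i \<noteq> j \<longrightarrow> ip (w i) (w j) = 0)"

definition orth_proj :: "'v set \<Rightarrow> 'v \<Rightarrow> 'v" where
  "orth_proj W x = (THE y. y \<in> W \<and> (\<forall>w\<in>W. ip w (x - y) = 0))"

text \<open>
  The exterior algebra is the tensor algebra modulo the two-sided ideal generated by the
  squares \<open>a \<otimes> a\<close>. A formal linear combination of lists stands for an element
  of the tensor algebra, the list \<open>[v\<^sub>1, \<dots>, v\<^sub>p]\<close> for \<open>v\<^sub>1 \<otimes> \<dots> \<otimes> v\<^sub>p\<close>, and \<open>ext_rel\<close> contains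
  exactly the combinations that represent 0 in the exterior algebra: the rules for \<open>add\<close> and
  \<open>scale\<close> give multilinearity, the rule for \<open>square\<close> gives the ideal. Because of the coefficient
  \<open>c\<close>, closure under addition suffices to make it a subspace.
\<close>

inductive_set ext_rel :: "('v list \<Rightarrow>\<^sub>0 'k) set" where
  zero: "0 \<in> ext_rel"
| plus: "f \<in> ext_rel \<Longrightarrow> g \<in> ext_rel \<Longrightarrow> f + g \<in> ext_rel"
| add: "Poly_Mapping.single (us @ (a + b) # vs) c
        - Poly_Mapping.single (us @ a # vs) c - Poly_Mapping.single (us @ b # vs) c \<in> ext_rel"
| scale: "Poly_Mapping.single (us @ (r *s a) # vs) c
        - Poly_Mapping.single (us @ a # vs) (c * r) \<in> ext_rel"
| square: "Poly_Mapping.single (us @ a # a # vs) c \<in> ext_rel"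

text \<open>Multivectors are the cosets of \<open>ext_rel\<close>.\<close>

definition ext_class :: "('v list \<Rightarrow>\<^sub>0 'k) \<Rightarrow> ('v list \<Rightarrow>\<^sub>0 'k) set" where
  "ext_class f = {g. g - f \<in> ext_rel}"

definition wedge :: "'v list \<Rightarrow> ('v list \<Rightarrow>\<^sub>0 'k) set" where
  "wedge vs = ext_class (Poly_Mapping.single vs 1)"

definition ext_scalar :: "'k \<Rightarrow> ('v list \<Rightarrow>\<^sub>0 'k) set" where
  "ext_scalar c = ext_class (Poly_Mapping.single [] c)"

text \<open>The nonzero blade \<open>\<nu>\<close> represents the subspace \<open>V\<close>; the first disjunct is the case of
  0-blades.\<close>

definition represents :: "('v list \<Rightarrow>\<^sub>0 'k) set \<Rightarrow> 'v set \<Rightarrow> bool" where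
  "represents \<nu> V \<longleftrightarrow> \<nu> \<noteq> ext_class 0 \<and>
     ((\<exists>c. \<nu> = ext_scalar c \<and> V = {0}) \<or>
      (\<exists>vs. vs \<noteq> [] \<and> \<nu> = wedge vs \<and> V = span (set vs)))"

text \<open>The inner product of two products of vectors (and of scalars, via the empty lists), and its
  sesquilinear extension. The latter is constant on cosets, as shown below.\<close>

definition gram :: "'v list \<Rightarrow> 'v list \<Rightarrow> 'k" where
  "gram xs ys = (if length xs = length ys
     then det (mat (length xs) (length xs) (\<lambda>(i, j). ip (xs ! i) (ys ! j))) else 0)"

definition gram_form :: "('v list \<Rightarrow>\<^sub>0 'k) \<Rightarrow> ('v list \<Rightarrow>\<^sub>0 'k) \<Rightarrow> 'k" where
  "gram_form f g = (\<Sum>xs\<in>Poly_Mapping.keys f. \<Sum>ys\<in>Poly_Mapping.keys g.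
     conjugate (Poly_Mapping.lookup f xs) * Poly_Mapping.lookup g ys * gram xs ys)"

definition ext_inner :: "('v list \<Rightarrow>\<^sub>0 'k) set \<Rightarrow> ('v list \<Rightarrow>\<^sub>0 'k) set \<Rightarrow> 'k" where
  "ext_inner A B = (THE c. \<forall>f\<in>A. \<forall>g\<in>B. gram_form f g = c)"

text \<open>Since \<open>\<langle>\<nu>, \<nu>\<rangle>\<close> is a nonnegative real element of \<open>'k\<close>, applying \<open>norm\<close> only turns it into an
  element of type \<open>real\<close>.\<close>

definition ext_norm :: "('v list \<Rightarrow>\<^sub>0 'k) set \<Rightarrow> real" where
  "ext_norm \<nu> = sqrt (norm (ext_inner \<nu> \<nu>))"

text \<open>The action of a linear map \<open>T\<close> on multivectors,
  \<open>T (v\<^sub>1 \<and> \<dots> \<and> v\<^sub>p) = T v\<^sub>1 \<and> \<dots> \<and> T v\<^sub>p\<close>.\<close>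

definition free_map :: "('v \<Rightarrow> 'v) \<Rightarrow> ('v list \<Rightarrow>\<^sub>0 'k) \<Rightarrow> ('v list \<Rightarrow>\<^sub>0 'k)" where
  "free_map T f = (\<Sum>xs\<in>Poly_Mapping.keys f.
     Poly_Mapping.single (map T xs) (Poly_Mapping.lookup f xs))"

definition ext_map :: "('v \<Rightarrow> 'v) \<Rightarrow> ('v list \<Rightarrow>\<^sub>0 'k) set \<Rightarrow> ('v list \<Rightarrow>\<^sub>0 'k) set" where
  "ext_map T A = (\<Union>f\<in>A. ext_class (free_map T f))"

definition grassmann_angle :: "'v set \<Rightarrow> 'v set \<Rightarrow> real" where
  "grassmann_angle V W = (THE \<theta>. 0 \<le> \<theta> \<and> \<theta> \<le> pi / 2 \<and>
     (\<forall>\<nu>. represents \<nu> V \<longrightarrow> cos \<theta> = ext_norm (ext_map (orth_proj W) \<nu>) / ext_norm \<nu>))"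

text \<open>For \<open>I = [i\<^sub>1, \<dots>, i\<^sub>p]\<close>; the empty multi-index gives the zero subspace.\<close>

definition coord_subspace :: "(nat \<Rightarrow> 'v) \<Rightarrow> nat list \<Rightarrow> 'v set" where
  "coord_subspace w I = span (w ` set I)"

end

text \<open>Multi-indices are strictly increasing lists. The single multi-index for \<open>p = 0\<close> is the
  empty list.\<close>

definition multi_indices :: "nat \<Rightarrow> nat \<Rightarrow> nat list set" where
  "multi_indices p q = {I. length I = p \<and> sorted_wrt (<) I \<and> set I \<subseteq> {1..q}}"


subsection \<open>Well-definedness of the operations on multivectors\<close>

lemma det_row_linear:
  fixes f g h :: "nat \<times> nat \<Rightarrow> 'a::comm_ring_1"
  assumes k: "k < n"
    and row: "\<And>j. j < n \<Longrightarrow> f (k, j) = s * g (k, j) + t * h (k, j)"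
    and g: "\<And>i j. i < n \<Longrightarrow> i \<noteq> k \<Longrightarrow> j < n \<Longrightarrow> g (i, j) = f (i, j)"
    and h: "\<And>i j. i < n \<Longrightarrow> i \<noteq> k \<Longrightarrow> j < n \<Longrightarrow> h (i, j) = f (i, j)"
  shows "det (mat n n f) = s * det (mat n n g) + t * det (mat n n h)"
proof -
  have prod: "(\<Prod>i = 0..<n. mat n n f $$ (i, p i)) =
      s * (\<Prod>i = 0..<n. mat n n g $$ (i, p i)) + t * (\<Prod>i = 0..<n. mat n n h $$ (i, p i))"
    if p: "p permutes {0..<n}" for p
  proof -
    have lt: "p i < n" if "i < n" for i
      using permutes_in_image[OF p, of i] that by simp
    have split: "(\<Prod>i = 0..<n. mat n n u $$ (i, p i)) = u (k, p k) * (\<Prod>i\<in>{0..<n} - {k}. u (i, p i))"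
      for u :: "nat \<times> nat \<Rightarrow> 'a"
    proof -
      have "(\<Prod>i = 0..<n. mat n n u $$ (i, p i)) = (\<Prod>i = 0..<n. u (i, p i))"
        by (rule prod.cong) (auto simp: lt)
      also have "\<dots> = u (k, p k) * (\<Prod>i\<in>{0..<n} - {k}. u (i, p i))"
        by (rule prod.remove) (use k in auto)
      finally show ?thesis .
    qed
    have "(\<Prod>i\<in>{0..<n} - {k}. g (i, p i)) = (\<Prod>i\<in>{0..<n} - {k}. f (i, p i))"
      by (rule prod.cong) (auto simp: g lt)
    moreover have "(\<Prod>i\<in>{0..<n} - {k}. h (i, p i)) = (\<Prod>i\<in>{0..<n} - {k}. f (i, p i))"
      by (rule prod.cong) (auto simp: h lt)
    ultimately show ?thesis
      unfolding split row[OF lt[OF k]] by (simp add: algebra_simps)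
  qed
  have "det (mat n n f) = (\<Sum>p | p permutes {0..<n}. signof p * (\<Prod>i = 0..<n. mat n n f $$ (i, p i)))"
    by (rule det_def'[OF mat_carrier])
  also have "\<dots> = (\<Sum>p | p permutes {0..<n}.
      s * (signof p * (\<Prod>i = 0..<n. mat n n g $$ (i, p i))) +
      t * (signof p * (\<Prod>i = 0..<n. mat n n h $$ (i, p i))))"
    by (rule sum.cong) (simp_all only: mem_Collect_eq prod distrib_left mult.left_commute)
  also have "\<dots> = s * det (mat n n g) + t * det (mat n n h)"
    by (simp only: det_def'[OF mat_carrier] sum.distrib sum_distrib_left)
  finally show ?thesis .
qed

lemma conjugate_one: "conjugate (1::'k::conjugatable_field) = 1"
proof -
  have "conjugate (1::'k) * conjugate 1 = conjugate 1 * 1"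
    by (simp flip: conjugate_dist_mul)
  moreover have "conjugate (1::'k) \<noteq> 0"
    by simp
  ultimately show ?thesis by (metis mult_cancel_left)
qed

lemma comm_ring_hom_conjugate: "comm_ring_hom (conjugate :: 'k::conjugatable_field \<Rightarrow> 'k)"
  by standard (simp_all add: conjugate_dist_mul conjugate_dist_add conjugate_one)

context fin_dim_inner_space
begin

lemma ip_add_left: "ip (x + y) z = ip x z + ip y z"
  by (metis ip_conjugate ip_add_right conjugate_dist_add)

lemma ip_scale_left: "ip (c *s x) z = conjugate c * ip x z"
  by (metis ip_conjugate ip_scale_right conjugate_dist_mul)

lemma gram_conjugate: "gram ys xs = conjugate (gram xs ys)"
proof (cases "length xs = length ys")
  case True
  interpret cj: comm_ring_hom "conjugate :: 'k \<Rightarrow> 'k" by (rule comm_ring_hom_conjugate)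
  let ?n = "length xs"
  have "mat ?n ?n (\<lambda>(i, j). ip (ys ! i) (xs ! j)) =
      transpose_mat (map_mat conjugate (mat ?n ?n (\<lambda>(i, j). ip (xs ! i) (ys ! j))))"
    by (rule eq_matI) (auto simp flip: ip_conjugate)
  then show ?thesis
    using True by (simp add: gram_def det_transpose[of _ ?n])
qed (simp add: gram_def)

lemma gram_add: "gram (us @ (a + b) # vs) ys = gram (us @ a # vs) ys + gram (us @ b # vs) ys"
proof (cases "length ys = Suc (length us + length vs)")
  case True
  let ?n = "Suc (length us + length vs)"
  let ?m = "\<lambda>x (i, j). ip ((us @ x # vs) ! i) (ys ! j)"
  have "det (mat ?n ?n (?m (a + b))) = 1 * det (mat ?n ?n (?m a)) + 1 * det (mat ?n ?n (?m b))"
    by (rule det_row_linear[of "length us"]) (auto simp: ip_add_left nth_append nth_Cons')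
  then show ?thesis using True by (simp add: gram_def)
qed (simp add: gram_def)

lemma gram_scale: "gram (us @ (r *s a) # vs) ys = conjugate r * gram (us @ a # vs) ys"
proof (cases "length ys = Suc (length us + length vs)")
  case True
  let ?n = "Suc (length us + length vs)"
  let ?m = "\<lambda>x (i, j). ip ((us @ x # vs) ! i) (ys ! j)"
  have "det (mat ?n ?n (?m (r *s a))) = conjugate r * det (mat ?n ?n (?m a)) + 0 * det (mat ?n ?n (?m a))"
    by (rule det_row_linear[of "length us"]) (auto simp: ip_scale_left nth_append nth_Cons')
  then show ?thesis using True by (simp add: gram_def)
qed (simp add: gram_def)

lemma gram_square: "gram (us @ a # a # vs) ys = 0"
proof (cases "length ys = Suc (Suc (length us + length vs))")
  case True
  let ?n = "Suc (Suc (length us + length vs))"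
  have "det (mat ?n ?n (\<lambda>(i, j). ip ((us @ a # a # vs) ! i) (ys ! j))) = 0"
    by (rule det_identical_rows[of _ ?n "length us" "Suc (length us)"])
      (auto simp: nth_append nth_Cons' intro!: eq_vecI)
  then show ?thesis using True by (simp add: gram_def)
qed (simp add: gram_def)

lemma gram_form_superset:
  assumes "finite S" "Poly_Mapping.keys f \<subseteq> S" "finite T" "Poly_Mapping.keys g \<subseteq> T"
  shows "gram_form f g = (\<Sum>xs\<in>S. \<Sum>ys\<in>T.
    conjugate (Poly_Mapping.lookup f xs) * Poly_Mapping.lookup g ys * gram xs ys)"
proof -
  have "(\<Sum>ys\<in>Poly_Mapping.keys g. conjugate (Poly_Mapping.lookup f xs) * Poly_Mapping.lookup g ys * gram xs ys)
      = (\<Sum>ys\<in>T. conjugate (Poly_Mapping.lookup f xs) * Poly_Mapping.lookup g ys * gram xs ys)" for xs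
    by (rule sum.mono_neutral_left) (use assms in \<open>auto simp: in_keys_iff\<close>)
  then have "gram_form f g = (\<Sum>xs\<in>Poly_Mapping.keys f. \<Sum>ys\<in>T.
      conjugate (Poly_Mapping.lookup f xs) * Poly_Mapping.lookup g ys * gram xs ys)"
    by (simp add: gram_form_def)
  also have "\<dots> = (\<Sum>xs\<in>S. \<Sum>ys\<in>T.
      conjugate (Poly_Mapping.lookup f xs) * Poly_Mapping.lookup g ys * gram xs ys)"
    by (rule sum.mono_neutral_left) (use assms in \<open>auto simp: in_keys_iff\<close>)
  finally show ?thesis .
qed

lemma gram_form_add_left: "gram_form (f + g) h = gram_form f h + gram_form g h"
proof -
  let ?S = "Poly_Mapping.keys f \<union> Poly_Mapping.keys g"
  have keys: "Poly_Mapping.keys (f + g) \<subseteq> ?S" by (rule keys_add)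
  have "gram_form (f + g) h = (\<Sum>xs\<in>?S. \<Sum>ys\<in>Poly_Mapping.keys h.
      conjugate (Poly_Mapping.lookup (f + g) xs) * Poly_Mapping.lookup h ys * gram xs ys)"
    by (rule gram_form_superset) (use keys in auto)
  also have "\<dots> = (\<Sum>xs\<in>?S. \<Sum>ys\<in>Poly_Mapping.keys h.
      conjugate (Poly_Mapping.lookup f xs) * Poly_Mapping.lookup h ys * gram xs ys) +
     (\<Sum>xs\<in>?S. \<Sum>ys\<in>Poly_Mapping.keys h.
      conjugate (Poly_Mapping.lookup g xs) * Poly_Mapping.lookup h ys * gram xs ys)"
    by (simp add: lookup_add conjugate_dist_add algebra_simps sum.distrib)
  also have "\<dots> = gram_form f h + gram_form g h"
    by (subst (1 2) gram_form_superset[where S = ?S and T = "Poly_Mapping.keys h"]) auto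
  finally show ?thesis .
qed

lemma gram_form_zero_left: "gram_form 0 h = 0"
  by (simp add: gram_form_def)

lemma gram_form_diff_left: "gram_form (f - g) h = gram_form f h - gram_form g h"
  using gram_form_add_left[of "f - g" g h] by simp

lemma gram_form_conjugate: "gram_form g f = conjugate (gram_form f g)"
proof -
  have "conjugate (gram_form f g) = (\<Sum>xs\<in>Poly_Mapping.keys f. \<Sum>ys\<in>Poly_Mapping.keys g.
      conjugate (Poly_Mapping.lookup g ys) * Poly_Mapping.lookup f xs * gram ys xs)"
    by (simp add: gram_form_def sum_conjugate conjugate_dist_mul gram_conjugate[symmetric]
        mult.commute mult.left_commute)
  also have "\<dots> = gram_form g f"
    unfolding gram_form_def by (rule sum.swap)
  finally show ?thesis by simp
qed

lemma gram_form_single_left: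
  "gram_form (Poly_Mapping.single xs c) h =
     conjugate c * (\<Sum>ys\<in>Poly_Mapping.keys h. Poly_Mapping.lookup h ys * gram xs ys)"
proof -
  have "gram_form (Poly_Mapping.single xs c) h = (\<Sum>zs\<in>{xs}. \<Sum>ys\<in>Poly_Mapping.keys h.
    conjugate (Poly_Mapping.lookup (Poly_Mapping.single xs c) zs) * Poly_Mapping.lookup h ys * gram zs ys)"
    by (rule gram_form_superset) auto
  then show ?thesis by (simp add: sum_distrib_left mult.assoc)
qed

lemma gram_form_ext_rel_left: "f \<in> ext_rel \<Longrightarrow> gram_form f h = 0"
proof (induction rule: ext_rel.induct)
  case (add us a b vs c)
  show ?case
    by (simp add: gram_form_diff_left gram_form_single_left gram_add distrib_left sum.distrib)
next
  case (scale us r a vs c)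
  show ?case
    by (simp add: gram_form_diff_left gram_form_single_left gram_scale conjugate_dist_mul
        sum_distrib_left mult.assoc mult.left_commute)
next
  case (square us a vs c)
  show ?case
    by (simp add: gram_form_single_left gram_square)
qed (simp_all add: gram_form_zero_left gram_form_add_left)

lemma gram_form_cong:
  assumes "f \<in> ext_class f'" "g \<in> ext_class g'"
  shows "gram_form f g = gram_form f' g'"
proof -
  have left: "gram_form a h = gram_form b h" if "a \<in> ext_class b" for a b h
    using gram_form_ext_rel_left[of "a - b" h] that by (simp add: ext_class_def gram_form_diff_left)
  show ?thesis
    using left[OF assms(1), of g] left[OF assms(2), of f'] by (metis gram_form_conjugate)
qed

lemma ext_class_self: "f \<in> ext_class f"
  by (simp add: ext_class_def ext_rel.zero)

lemma ext_inner_ext_class: "ext_inner (ext_class f) (ext_class g) = gram_form f g"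
  unfolding ext_inner_def
proof (rule the_equality)
  show "\<forall>f'\<in>ext_class f. \<forall>g'\<in>ext_class g. gram_form f' g' = gram_form f g"
    using gram_form_cong by simp
next
  fix c assume "\<forall>f'\<in>ext_class f. \<forall>g'\<in>ext_class g. gram_form f' g' = c"
  then show "c = gram_form f g" using ext_class_self by force
qed

lemma ext_inner_wedge: "ext_inner (wedge xs) (wedge ys) = gram xs ys"
  by (simp add: wedge_def ext_inner_ext_class gram_form_single_left conjugate_one)

lemma free_map_superset:
  assumes "finite S" "Poly_Mapping.keys f \<subseteq> S"
  shows "free_map T f = (\<Sum>xs\<in>S. Poly_Mapping.single (map T xs) (Poly_Mapping.lookup f xs))"
  unfolding free_map_def by (rule sum.mono_neutral_left) (use assms in \<open>auto simp: in_keys_iff\<close>)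

lemma free_map_add: "free_map T (f + g) = free_map T f + free_map T g"
proof -
  let ?S = "Poly_Mapping.keys f \<union> Poly_Mapping.keys g"
  have keys: "Poly_Mapping.keys (f + g) \<subseteq> ?S" by (rule keys_add)
  show ?thesis
    by (subst (1 2 3) free_map_superset[where S = ?S])
      (use keys in \<open>auto simp: lookup_add single_add sum.distrib\<close>)
qed

lemma free_map_diff: "free_map T (f - g) = free_map T f - free_map T g"
  using free_map_add[of T "f - g" g] by simp

lemma free_map_single: "free_map T (Poly_Mapping.single xs c) = Poly_Mapping.single (map T xs) c"
  by (subst free_map_superset[where S = "{xs}"]) auto

lemma free_map_ext_rel:
  assumes add: "\<And>x y. T (x + y) = T x + T y" and scale: "\<And>c x. T (c *s x) = c *s T x"
  shows "f \<in> ext_rel \<Longrightarrow> free_map T f \<in> ext_rel"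
proof (induction rule: ext_rel.induct)
  case zero
  then show ?case by (simp add: free_map_def ext_rel.zero)
next
  case (plus f g)
  then show ?case by (simp add: free_map_add ext_rel.plus)
next
  case (add us a b vs c)
  show ?case
    by (simp only: free_map_diff free_map_single map_append list.map assms(1) ext_rel.add)
next
  case (scale us r a vs c)
  show ?case
    by (simp only: free_map_diff free_map_single map_append list.map assms(2) ext_rel.scale)
next
  case (square us a vs c)
  show ?case
    by (simp only: free_map_single map_append list.map ext_rel.square)
qed

lemma ext_map_ext_class:
  assumes add: "\<And>x y. T (x + y) = T x + T y" and scale: "\<And>c x. T (c *s x) = c *s T x"
  shows "ext_map T (ext_class f) = ext_class (free_map T f)"
proof -
  have "ext_class (free_map T g) \<subseteq> ext_class (free_map T f)" if "g \<in> ext_class f" for g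
  proof
    fix h assume "h \<in> ext_class (free_map T g)"
    moreover have "free_map T g - free_map T f \<in> ext_rel"
      using free_map_ext_rel[OF add scale, of "g - f"] that
      by (simp add: ext_class_def free_map_diff)
    ultimately have "(h - free_map T g) + (free_map T g - free_map T f) \<in> ext_rel"
      unfolding ext_class_def by (blast intro: ext_rel.plus)
    then show "h \<in> ext_class (free_map T f)" by (simp add: ext_class_def)
  qed
  then show ?thesis
    unfolding ext_map_def using ext_class_self by blast
qed

lemma ext_map_wedge:
  assumes "\<And>x y. T (x + y) = T x + T y" and "\<And>c x. T (c *s x) = c *s T x"
  shows "ext_map T (wedge vs) = wedge (map T vs)"
  using ext_map_ext_class[OF assms] by (simp add: wedge_def free_map_single)

end

end

theory Submission
  imports Defs
begin

text \<open>
  Take a basis \<open>v\<^sub>1, \<dots>, v\<^sub>p\<close> of \<open>V\<close> and let \<open>C\<close> be the \<open>n \<times> p\<close> matrix of its coordinates with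
  respect to the normalized basis of \<open>X\<close>. The Gram matrix of the projections of the \<open>v\<^sub>j\<close> onto
  \<open>W\<^sub>I\<close> is \<open>C\<^sub>I\<^sup>* C\<^sub>I\<close>, where \<open>C\<^sub>I\<close> consists of the rows of \<open>C\<close> indexed by \<open>I\<close>, so the squared norm of
  the projected blade is \<open>|det C\<^sub>I|\<^sup>2\<close>. By the Cauchy--Binet formula these add up to
  \<open>det (C\<^sup>* C)\<close>, the squared norm of the blade itself. Another blade for \<open>V\<close> multiplies all
  the \<open>det C\<^sub>I\<close> by the same factor.
\<close>

subsection \<open>The Cauchy--Binet formula\<close>

text \<open>In the Leibniz formula each product of sums expands, by distributivity, over the choice
  functions \<open>f\<close>. Once the sums are exchanged, the sum over permutations is the
  determinant of the matrix with rows \<open>B (f i)\<close>.\<close>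

lemma det_sum_product_PiE:
  fixes A B :: "nat \<Rightarrow> nat \<Rightarrow> 'a::comm_ring_1"
  assumes K: "finite K"
  shows "det (mat p p (\<lambda>(i, j). \<Sum>k\<in>K. A i k * B k j)) =
    (\<Sum>f\<in>{0..<p} \<rightarrow>\<^sub>E K. (\<Prod>i = 0..<p. A i (f i)) * det (mat p p (\<lambda>(i, j). B (f i) j)))"
proof -
  let ?F = "{0..<p} \<rightarrow>\<^sub>E K"
  have lt: "\<sigma> i < p" if "\<sigma> permutes {0..<p}" "i < p" for \<sigma> i
    using permutes_in_image[OF that(1), of i] that(2) by simp
  have "det (mat p p (\<lambda>(i, j). \<Sum>k\<in>K. A i k * B k j)) =
      (\<Sum>\<sigma> | \<sigma> permutes {0..<p}. signof \<sigma> * (\<Prod>i = 0..<p. \<Sum>k\<in>K. A i k * B k (\<sigma> i)))"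
    unfolding det_def'[OF mat_carrier]
    by (intro sum.cong arg_cong2[where f = "(*)"] prod.cong refl) (simp add: lt)
  also have "\<dots> = (\<Sum>\<sigma> | \<sigma> permutes {0..<p}. \<Sum>f\<in>?F. signof \<sigma> * (\<Prod>i = 0..<p. A i (f i) * B (f i) (\<sigma> i)))"
    using K by (simp add: prod_sum_PiE sum_distrib_left)
  also have "\<dots> = (\<Sum>f\<in>?F. \<Sum>\<sigma> | \<sigma> permutes {0..<p}. signof \<sigma> * (\<Prod>i = 0..<p. A i (f i) * B (f i) (\<sigma> i)))"
    by (rule sum.swap)
  also have "\<dots> = (\<Sum>f\<in>?F. (\<Prod>i = 0..<p. A i (f i)) * det (mat p p (\<lambda>(i, j). B (f i) j)))"
  proof (rule sum.cong[OF refl])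
    fix f
    show "(\<Sum>\<sigma> | \<sigma> permutes {0..<p}. signof \<sigma> * (\<Prod>i = 0..<p. A i (f i) * B (f i) (\<sigma> i))) =
        (\<Prod>i = 0..<p. A i (f i)) * det (mat p p (\<lambda>(i, j). B (f i) j))"
      unfolding det_def'[OF mat_carrier] sum_distrib_left
      by (intro sum.cong refl) (simp add: prod.distrib lt algebra_simps cong: prod.cong_simp)
  qed
  finally show ?thesis .
qed

lemma finite_multi_indices: "finite (multi_indices p n)"
  by (rule finite_subset[OF _ finite_lists_length_eq[of "{1..n}" p]]) (auto simp: multi_indices_def)

text \<open>The maps \<open>f\<close> are the composites of the enumeration \<open>k \<mapsto> I ! k\<close> with the permutations of
  the indices, so the sum is the Leibniz formula for the first determinant.\<close>

lemma sum_bij_eq_det: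
  fixes A B :: "nat \<Rightarrow> nat \<Rightarrow> 'a::comm_ring_1"
  assumes I: "distinct I" "length I = p"
  shows "(\<Sum>f | f \<in> extensional {0..<p} \<and> inj_on f {0..<p} \<and> f ` {0..<p} = set I.
      (\<Prod>i = 0..<p. A i (f i)) * det (mat p p (\<lambda>(i, j). B (f i) j))) =
    det (mat p p (\<lambda>(i, k). A i (I ! k))) * det (mat p p (\<lambda>(k, j). B (I ! k) j))"
    (is "sum ?h ?F = ?A * ?B")
proof -
  let ?P = "{0..<p}"
  have nth: "bij_betw ((!) I) ?P (set I)"
    using bij_betw_nth[OF I(1) refl refl] I(2) by (simp add: atLeast0LessThan)
  have lt: "\<sigma> i < p" if "\<sigma> permutes ?P" "i < p" for \<sigma> i
    using permutes_in_image[OF that(1), of i] that(2) by simp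
  have "sum ?h ?F = (\<Sum>\<sigma> | \<sigma> permutes ?P. ?h (\<lambda>i\<in>?P. I ! \<sigma> i))"
  \<comment> \<open>Functions in \<open>?F\<close> are \<open>undefined\<close> outside
    \<open>?P\<close>, whereas permutations fix the points there; hence the restriction in one
    direction and the \<open>else i\<close> in the other.\<close>
  proof (rule sum.reindex_bij_witness[where i = "\<lambda>\<sigma>. \<lambda>i\<in>?P. I ! \<sigma> i" and
        j = "\<lambda>f i. if i \<in> ?P then inv_into ?P ((!) I) (f i) else i"])
    fix f assume "f \<in> ?F"
    then have f: "f \<in> extensional ?P" "bij_betw f ?P (set I)" by (auto simp: bij_betw_def)
    then have fI: "f i \<in> set I" if "i < p" for i using that by (auto simp: bij_betw_def)
    have eq: "I ! inv_into ?P ((!) I) (f i) = f i" if "i < p" for i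
      using bij_betw_inv_into_right[OF nth fI[OF that]] .
    show fe: "(\<lambda>i\<in>?P. I ! (if i \<in> ?P then inv_into ?P ((!) I) (f i) else i)) = f"
      using f(1) by (auto simp: fun_eq_iff extensional_def eq)
    have "bij_betw (\<lambda>i. inv_into ?P ((!) I) (f i)) ?P ?P"
      using bij_betw_trans[OF f(2) bij_betw_inv_into[OF nth]] by (simp add: o_def)
    then have "bij_betw (\<lambda>i. if i \<in> ?P then inv_into ?P ((!) I) (f i) else i) ?P ?P"
      by (subst bij_betw_cong[where g = "\<lambda>i. inv_into ?P ((!) I) (f i)"]) auto
    then show "(\<lambda>i. if i \<in> ?P then inv_into ?P ((!) I) (f i) else i) \<in> {\<sigma>. \<sigma> permutes ?P}"
      by (auto intro: bij_imp_permutes)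
    show "?h (\<lambda>i\<in>?P. I ! (if i \<in> ?P then inv_into ?P ((!) I) (f i) else i)) = ?h f"
      by (simp only: fe)
  next
    fix \<sigma> assume "\<sigma> \<in> {\<sigma>. \<sigma> permutes ?P}"
    then have \<sigma>: "\<sigma> permutes ?P" by simp
    show "(\<lambda>i. if i \<in> ?P then inv_into ?P ((!) I) ((\<lambda>i\<in>?P. I ! \<sigma> i) i) else i) = \<sigma>"
      using permutes_not_in[OF \<sigma>] lt[OF \<sigma>] bij_betw_inv_into_left[OF nth]
      by (auto simp: fun_eq_iff)
    have "bij_betw (\<lambda>i. I ! \<sigma> i) ?P (set I)"
      using bij_betw_trans[OF permutes_imp_bij[OF \<sigma>] nth] by (simp add: o_def)
    then have "bij_betw (\<lambda>i\<in>?P. I ! \<sigma> i) ?P (set I)"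
      by (subst bij_betw_cong[where g = "\<lambda>i. I ! \<sigma> i"]) auto
    then show "(\<lambda>i\<in>?P. I ! \<sigma> i) \<in> ?F"
      by (auto simp: bij_betw_def)
  qed
  also have "\<dots> = (\<Sum>\<sigma> | \<sigma> permutes ?P. (signof \<sigma> * (\<Prod>i\<in>?P. A i (I ! \<sigma> i))) * ?B)"
  proof (rule sum.cong[OF refl])
    fix \<sigma> assume "\<sigma> \<in> {\<sigma>. \<sigma> permutes ?P}"
    then have \<sigma>: "\<sigma> permutes ?P" by simp
    \<comment> \<open>The rows of the matrix in \<open>?B\<close> are permuted by
      \<open>\<sigma>\<close>; the resulting sign completes the Leibniz formula for
      \<open>?A\<close>.\<close>
    have "det (mat p p (\<lambda>(i, j). B ((\<lambda>i\<in>?P. I ! \<sigma> i) i) j)) =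
        det (mat p p (\<lambda>(i, j). mat p p (\<lambda>(k, j). B (I ! k) j) $$ (\<sigma> i, j)))"
      by (rule arg_cong[where f = det]) (auto simp: lt[OF \<sigma>])
    also have "\<dots> = signof \<sigma> * ?B"
      by (rule det_permute_rows[OF mat_carrier \<sigma>])
    finally show "?h (\<lambda>i\<in>?P. I ! \<sigma> i) = (signof \<sigma> * (\<Prod>i\<in>?P. A i (I ! \<sigma> i))) * ?B"
      by (simp add: algebra_simps)
  qed
  also have "\<dots> = ?A * ?B"
    unfolding sum_distrib_right[symmetric] det_def'[OF mat_carrier]
    by (intro arg_cong2[where f = "(*)"] sum.cong prod.cong refl) (simp add: lt)
  finally show ?thesis .
qed

text \<open>Only the injective choice functions survive, since a repeated value repeats a row of
  \<open>B\<close>. Their images, listed in increasing order, are multi-indices, and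
  \<open>sum_bij_eq_det\<close> evaluates the group of functions with a given image.\<close>

theorem cauchy_binet:
  fixes A B :: "nat \<Rightarrow> nat \<Rightarrow> 'a::comm_ring_1"
  shows "det (mat p p (\<lambda>(i, j). \<Sum>k = 1..n. A i k * B k j)) =
    (\<Sum>I\<in>multi_indices p n.
      det (mat p p (\<lambda>(i, k). A i (I ! k))) * det (mat p p (\<lambda>(k, j). B (I ! k) j)))"
proof -
  let ?P = "{0..<p}"
  let ?F = "?P \<rightarrow>\<^sub>E {1..n}"
  let ?h = "\<lambda>f. (\<Prod>i = 0..<p. A i (f i)) * det (mat p p (\<lambda>(i, j). B (f i) j))"
  let ?G = "{f \<in> ?F. inj_on f ?P}"
  let ?g = "\<lambda>f. sorted_list_of_set (f ` ?P)"
  have fin: "finite ?F" by (intro finite_PiE) auto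
  have "det (mat p p (\<lambda>(i, j). \<Sum>k = 1..n. A i k * B k j)) = sum ?h ?F"
    by (rule det_sum_product_PiE) simp
  also have "\<dots> = sum ?h ?G"
  proof (rule sum.mono_neutral_right[OF fin])
    show "\<forall>f\<in>?F - ?G. ?h f = 0"
    proof
      fix f assume "f \<in> ?F - ?G"
      then obtain i j where ij: "i < p" "j < p" "i \<noteq> j" "f i = f j"
        by (auto simp: inj_on_def)
      then have "det (mat p p (\<lambda>(i, j). B (f i) j)) = 0"
        by (intro det_identical_rows[of _ p i j]) (auto intro!: eq_vecI)
      then show "?h f = 0" by simp
    qed
  qed auto
  also have "\<dots> = (\<Sum>I\<in>multi_indices p n. sum ?h {f \<in> ?G. ?g f = I})"
  proof (rule sum.group[symmetric])
    show "finite ?G" using fin by simp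
    show "?g ` ?G \<subseteq> multi_indices p n"
      by (auto simp: multi_indices_def card_image PiE_iff)
  qed (rule finite_multi_indices)
  also have "\<dots> = (\<Sum>I\<in>multi_indices p n.
      det (mat p p (\<lambda>(i, k). A i (I ! k))) * det (mat p p (\<lambda>(k, j). B (I ! k) j)))"
  proof (rule sum.cong[OF refl])
    fix I assume I: "I \<in> multi_indices p n"
    then have d: "distinct I" "length I = p" and s: "sorted_list_of_set (set I) = I"
      by (auto simp: multi_indices_def strict_sorted_iff sorted_list_of_set.idem_if_sorted_distinct)
    have K: "set I \<subseteq> {1..n}" using I by (simp add: multi_indices_def)
    have "f \<in> {f \<in> ?G. ?g f = I} \<longleftrightarrow> f \<in> extensional ?P \<and> inj_on f ?P \<and> f ` ?P = set I" for f
    proof -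
      have "?g f = I \<longleftrightarrow> f ` ?P = set I"
        using s set_sorted_list_of_set[of "f ` ?P"] by auto
      moreover have "f \<in> ?F \<longleftrightarrow> f \<in> extensional ?P \<and> f ` ?P \<subseteq> {1..n}"
        by (auto simp: PiE_iff image_subset_iff)
      ultimately show ?thesis using K by blast
    qed
    then have "{f \<in> ?G. ?g f = I} =
        {f. f \<in> extensional ?P \<and> inj_on f ?P \<and> f ` ?P = set I}"
      by blast
    then show "sum ?h {f \<in> ?G. ?g f = I} =
        det (mat p p (\<lambda>(i, k). A i (I ! k))) * det (mat p p (\<lambda>(k, j). B (I ! k) j))"
      by (simp only: sum_bij_eq_det[OF d])
  qed
  finally show ?thesis .
qed


subsection \<open>Nonzero blades\<close>

text \<open>The class axiom evaluates only \<open>a * conjugate a\<close>; for real nonzero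
  \<open>a\<close>, cancelling \<open>a\<close> yields the conjugate itself.\<close>

lemma conjugate_of_real: "conjugate (of_real r :: 'k::real_or_complex) = of_real r"
proof (cases "r = 0")
  case False
  have "(of_real r :: 'k) * conjugate (of_real r) = of_real r * of_real r"
    by (simp add: mult_conjugate_norm power2_eq_square flip: of_real_def)
  with False show ?thesis by simp
qed simp

lemma conjugate_mult_self: "conjugate a * a = of_real ((norm (a :: 'k::real_or_complex))\<^sup>2)"
  by (simp add: mult.commute[of "conjugate a"] mult_conjugate_norm of_real_def)

context fin_dim_inner_space
begin

lemma ip_zero_right: "ip x 0 = 0"
  using ip_add_right[of x 0 0] by simp

lemma ip_zero_left: "ip 0 x = 0"
  using ip_add_left[of 0 0 x] by simp

lemma ip_diff_right: "ip x (y - z) = ip x y - ip x z"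
  using ip_add_right[of x "y - z" z] by simp

lemma ip_sum_right: "ip x (\<Sum>i\<in>S. f i) = (\<Sum>i\<in>S. ip x (f i))"
  by (induction S rule: infinite_finite_induct) (simp_all add: ip_zero_right ip_add_right)

lemma ip_sum_left: "ip (\<Sum>i\<in>S. f i) x = (\<Sum>i\<in>S. ip (f i) x)"
  by (induction S rule: infinite_finite_induct) (simp_all add: ip_zero_left ip_add_left)

lemma ip_self_eq_zero_iff: "ip x x = 0 \<longleftrightarrow> x = 0"
  by (cases "x = 0") (use ip_pos[of x] in \<open>auto simp: ip_zero_left\<close>)

lemma ip_self_norm: "ip x x = of_real (norm (ip x x))"
  by (cases "x = 0") (use ip_pos[of x] in \<open>auto simp: ip_zero_left\<close>)

section \<open>Linear dependence in the exterior algebra\<close>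

text \<open>The rules contain no negation, but every generator carries an arbitrary coefficient,
  whose sign can be changed.\<close>

lemma ext_rel_uminus: "f \<in> ext_rel \<Longrightarrow> - f \<in> ext_rel"
proof (induction rule: ext_rel.induct)
  case (plus f g)
  then show ?case using ext_rel.plus[of "- f" "- g"] by simp
next
  case (add us a b vs c)
  show ?case using ext_rel.add[of us a b vs "- c"] by (simp add: single_uminus algebra_simps)
next
  case (scale us r a vs c)
  show ?case using ext_rel.scale[of us r a vs "- c"] by (simp add: single_uminus)
next
  case (square us a vs c)
  show ?case using ext_rel.square[of us a vs "- c"] by (simp add: single_uminus)
qed (simp add: ext_rel.zero)

lemma ext_rel_diff: "f \<in> ext_rel \<Longrightarrow> g \<in> ext_rel \<Longrightarrow> f - g \<in> ext_rel"
  using ext_rel.plus[OF _ ext_rel_uminus] by fastforce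

lemma ext_class_eq_zero:
  assumes "f \<in> ext_rel"
  shows "ext_class f = ext_class 0"
proof -
  have "g - f \<in> ext_rel \<longleftrightarrow> g \<in> ext_rel" for g
    using ext_rel_diff[OF _ assms, of g] ext_rel.plus[OF _ assms, of "g - f"] by auto
  then show ?thesis by (simp add: ext_class_def)
qed

lemma ext_rel_swap:
  "Poly_Mapping.single (us @ a # b # vs) c + Poly_Mapping.single (us @ b # a # vs) c \<in> ext_rel"
proof -
  let ?E = "\<lambda>x y. Poly_Mapping.single (us @ x # y # vs) c"
  have left: "?E (a + b) y - ?E a y - ?E b y \<in> ext_rel" for y
    by (rule ext_rel.add)
  have right: "?E x (a + b) - ?E x a - ?E x b \<in> ext_rel" for x
    using ext_rel.add[of "us @ [x]" a b vs c] by simp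
  have square: "?E x x \<in> ext_rel" for x
    by (rule ext_rel.square)
  \<comment> \<open>expand the square of \<open>a + b\<close> and remove the squares of \<open>a\<close> and \<open>b\<close>\<close>
  have "?E (a + b) (a + b) - (?E (a + b) (a + b) - ?E a (a + b) - ?E b (a + b))
      - (?E a (a + b) - ?E a a - ?E a b) - (?E b (a + b) - ?E b a - ?E b b)
      - ?E a a - ?E b b \<in> ext_rel"
    by (rule ext_rel_diff ext_rel_diff[OF square left] right square)+
  then show ?thesis by simp
qed

text \<open>Modulo relations, \<open>ext_rel_swap\<close> moves the left copy of \<open>a\<close>
  past \<open>y\<close>, which joins the prefix; the two copies finally become adjacent.\<close>

lemma ext_rel_repeated:
  "Poly_Mapping.single (us @ a # ys @ a # zs) c \<in> ext_rel"
proof (induction ys arbitrary: us)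
  case Nil
  show ?case using ext_rel.square by simp
next
  case (Cons y ys)
  have "Poly_Mapping.single (us @ y # a # ys @ a # zs) c \<in> ext_rel"
    using Cons[of "us @ [y]"] by simp
  from ext_rel_diff[OF ext_rel_swap[of us a y "ys @ a # zs" c] this] show ?case by simp
qed

text \<open>Multilinearity replaces \<open>a\<close> by the other entries one at a time, and every
  resulting term has a repeated entry.\<close>

lemma ext_rel_span:
  assumes "a \<in> span (set us \<union> set vs)"
  shows "Poly_Mapping.single (us @ a # vs) c \<in> ext_rel"
  using assms
proof (induction a arbitrary: c rule: span_induct_alt)
  case base
  \<comment> \<open>The zero vector is \<open>0 *s 0\<close>, and the coefficient
    \<open>c * 0\<close> removes the second term of the rule.\<close>
  show ?case using ext_rel.scale[of us 0 0 vs c] by simp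
next
  case (step r x y)
  have "Poly_Mapping.single (us @ x # vs) c \<in> ext_rel" for c
  proof (cases "x \<in> set us")
    case True
    then obtain ys zs where "us = ys @ x # zs" by (auto simp: in_set_conv_decomp)
    then show ?thesis using ext_rel_repeated[of ys x zs vs] by simp
  next
    case False
    with step(1) obtain ys zs where "vs = ys @ x # zs" by (auto simp: in_set_conv_decomp)
    then show ?thesis using ext_rel_repeated[of us x ys zs] by simp
  qed
  then have "(Poly_Mapping.single (us @ (r *s x) # vs) c - Poly_Mapping.single (us @ x # vs) (c * r))
      + Poly_Mapping.single (us @ x # vs) (c * r) \<in> ext_rel"
    by (intro ext_rel.plus ext_rel.scale)
  then have "Poly_Mapping.single (us @ (r *s x) # vs) c \<in> ext_rel" by simp
  with step(2)[of c] have "(Poly_Mapping.single (us @ (r *s x + y) # vs) c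
        - Poly_Mapping.single (us @ (r *s x) # vs) c - Poly_Mapping.single (us @ y # vs) c)
      + Poly_Mapping.single (us @ (r *s x) # vs) c + Poly_Mapping.single (us @ y # vs) c \<in> ext_rel"
    by (intro ext_rel.plus ext_rel.add)
  then show ?case by simp
qed

text \<open>Otherwise some entry lies in the span of the entries at the other positions, and
  \<open>ext_rel_span\<close> makes the product zero. Distinctness is stated separately because
  \<open>set us\<close> does not see repetitions.\<close>

lemma wedge_nonzero_imp_independent:
  assumes "wedge us \<noteq> ext_class 0"
  shows "distinct us" "independent (set us)"
proof -
  have no: "a \<notin> span (set xs \<union> set ys)" if "us = xs @ a # ys" for xs a ys
    using ext_rel_span[of a xs ys 1] ext_class_eq_zero[of "Poly_Mapping.single us 1"] assms that
    by (auto simp: wedge_def)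
  show "distinct us"
  proof (rule ccontr)
    assume "\<not> distinct us"
    then obtain xs ys zs a where "us = xs @ [a] @ ys @ [a] @ zs"
      using not_distinct_decomp by blast
    then show False using no[of xs a "ys @ a # zs"] by (auto intro: span_base)
  qed
  show "independent (set us)"
  proof
    assume "dependent (set us)"
    then obtain a where a: "a \<in> set us" "a \<in> span (set us - {a})"
      by (auto simp: dependent_def)
    then obtain xs ys where us: "us = xs @ a # ys" by (auto simp: in_set_conv_decomp)
    then have "a \<in> span (set xs \<union> set ys)"
      using a(2) span_mono[of "set us - {a}" "set xs \<union> set ys"] by auto
    with no us show False by blast
  qed
qed

section \<open>Gram determinants and representing blades\<close>

text \<open>A kernel vector of a singular Gram matrix gives a linear combination \<open>x\<close> of
  the \<open>vs ! j\<close> that is orthogonal to all of them, hence to itself. So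
  \<open>x = 0\<close>, against independence.\<close>

lemma gram_nonzero:
  assumes "distinct vs" "independent (set vs)"
  shows "gram vs vs \<noteq> 0"
proof
  let ?p = "length vs"
  let ?G = "mat ?p ?p (\<lambda>(i, j). ip (vs ! i) (vs ! j))"
  assume "gram vs vs = 0"
  then have "det ?G = 0" by (simp add: gram_def)
  then obtain v where v: "v \<in> carrier_vec ?p" "v \<noteq> 0\<^sub>v ?p" "?G *\<^sub>v v = 0\<^sub>v ?p"
    using det_0_iff_vec_prod_zero[of ?G ?p] by auto
  define x where "x = (\<Sum>j<?p. v $ j *s (vs ! j))"
  have ortho: "ip (vs ! i) x = 0" if "i < ?p" for i
  proof -
    have "ip (vs ! i) x = (\<Sum>j<?p. ip (vs ! i) (vs ! j) * v $ j)"
      by (simp add: x_def ip_sum_right ip_scale_right mult.commute)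
    also have "\<dots> = (?G *\<^sub>v v) $ i"
      using that v(1) by (simp add: scalar_prod_def atLeast0LessThan)
    finally show ?thesis using v(3) that by simp
  qed
  have "ip x x = (\<Sum>j<?p. conjugate (v $ j) * ip (vs ! j) x)"
    by (subst x_def) (simp add: ip_sum_left ip_scale_left)
  then have "x = 0" by (simp add: ortho flip: ip_self_eq_zero_iff)
  have nth: "bij_betw ((!) vs) {..<?p} (set vs)"
    using assms(1) by (simp add: bij_betw_nth)
  \<comment> \<open>Coefficients are moved from positions to vectors, as independence of a set
    requires.\<close>
  define u where "u y = v $ inv_into {..<?p} ((!) vs) y" for y
  have u: "u (vs ! j) = v $ j" if "j < ?p" for j
    using bij_betw_inv_into_left[OF nth] that by (simp add: u_def)
  have "(\<Sum>y\<in>set vs. u y *s y) = x"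
    unfolding x_def by (subst sum.reindex_bij_betw[OF nth, symmetric]) (simp add: u)
  then have "u y = 0" if "y \<in> set vs" for y
    using independentD[OF assms(2) _ subset_refl _ that, of u] \<open>x = 0\<close> by simp
  then have "v $ j = 0" if "j < ?p" for j
    using u[OF that] that by simp
  then show False using v(1,2) by (auto intro!: eq_vecI)
qed

lemma wedge_nonzero:
  assumes "distinct vs" "independent (set vs)"
  shows "wedge vs \<noteq> ext_class 0"
proof
  assume "wedge vs = ext_class 0"
  then have "gram vs vs = gram_form 0 0"
    by (metis ext_inner_wedge ext_inner_ext_class)
  with gram_nonzero[OF assms] show False by (simp add: gram_form_zero_left)
qed

text \<open>Shows that the condition on representing blades in \<open>grassmann_angle\<close> is not
  vacuous. The empty list is the scalar 1, a 0-blade.\<close>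

lemma represents_wedge:
  assumes "distinct vs" "independent (set vs)"
  shows "represents (wedge vs) (span (set vs))"
proof (cases "vs = []")
  case True
  then have "wedge vs = ext_scalar 1" "span (set vs) = {0}"
    by (simp_all add: wedge_def ext_scalar_def)
  with wedge_nonzero[OF assms] show ?thesis by (auto simp: represents_def)
next
  case False
  with wedge_nonzero[OF assms] show ?thesis by (auto simp: represents_def)
qed

lemma obtain_basis_list:
  assumes "subspace V"
  obtains vs where "distinct vs" "independent (set vs)" "span (set vs) = V" "length vs = dim V"
proof -
  obtain B where B: "B \<subseteq> V" "independent B" "V \<subseteq> span B" "card B = dim V"
    using basis_exists[of V] by metis
  have "finite B"
    using fin_dim independent_span_bound[OF _ B(2)] by auto
  then obtain vs where "set vs = B" "distinct vs" using finite_distinct_list by blast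
  moreover have "span B = V" using B assms by (simp add: span_subspace)
  ultimately show ?thesis using that B by (metis distinct_card)
qed


subsection \<open>Projections to coordinate subspaces\<close>

text \<open>Coordinates with respect to the normalized basis vectors \<open>w i / \<parallel>w i\<parallel>\<close>; since the values of
  \<open>ip\<close> lie in \<open>'k\<close>, the squared length of \<open>w i\<close> is read off with \<open>norm\<close>.\<close>

definition coord :: "(nat \<Rightarrow> 'v) \<Rightarrow> nat \<Rightarrow> 'v \<Rightarrow> 'k" where
  "coord w i x = of_real (1 / sqrt (norm (ip (w i) (w i)))) * ip (w i) x"

text \<open>For an orthogonal basis and \<open>length I = length us\<close> this is a Pluecker
  coordinate: the component of the blade along the product of the normalized basis vectors indexed
  by \<open>I\<close>.\<close>

definition coord_det :: "(nat \<Rightarrow> 'v) \<Rightarrow> nat list \<Rightarrow> 'v list \<Rightarrow> 'k" where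
  "coord_det w I us =
    det (mat (length us) (length us) (\<lambda>(k, j). coord w (I ! k) (us ! j)))"

lemma coord_sum: "coord w i (\<Sum>j\<in>S. c j *s f j) = (\<Sum>j\<in>S. c j * coord w i (f j))"
  by (simp add: coord_def ip_sum_right ip_scale_right sum_distrib_left mult.left_commute)

text \<open>Expressing \<open>us\<close> through \<open>vs\<close> multiplies the coordinate
  matrices on the right by one matrix. Its determinant \<open>q\<close> depends on neither
  \<open>w\<close> nor \<open>I\<close>, so it can later be cancelled.\<close>

lemma coord_det_change_basis:
  assumes len: "length us = length vs" and "distinct vs" and "set us \<subseteq> span (set vs)"
  obtains q where "\<And>w I. coord_det w I us = coord_det w I vs * q"
proof -
  let ?p = "length vs"
  have "\<exists>c. us ! j = (\<Sum>b<?p. c b *s (vs ! b))" if "j < ?p" for j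
  proof -
    have "us ! j \<in> span (set vs)" using assms(3) len that by auto
    then obtain u where "us ! j = (\<Sum>y\<in>set vs. u y *s y)"
      by (auto simp: span_finite)
    then have "us ! j = (\<Sum>b<?p. u (vs ! b) *s (vs ! b))"
      using sum.reindex_bij_betw[OF bij_betw_nth[OF \<open>distinct vs\<close> refl refl], of "\<lambda>y. u y *s y"]
      by simp
    then show ?thesis by (rule exI[of _ "\<lambda>b. u (vs ! b)"])
  qed
  then obtain c where c: "us ! j = (\<Sum>b<?p. c j b *s (vs ! b))" if "j < ?p" for j
    by metis
  let ?Q = "mat ?p ?p (\<lambda>(b, j). c j b)"
  have "coord_det w I us = coord_det w I vs * det ?Q" for w I
  proof -
    let ?M = "\<lambda>us. mat ?p ?p (\<lambda>(k, j). coord w (I ! k) (us ! j))"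
    have "?M us = ?M vs * ?Q"
      by (rule eq_matI)
        (auto simp: c coord_sum scalar_prod_def atLeast0LessThan mult.commute)
    then show ?thesis
      by (simp add: coord_det_def len det_mult[of _ ?p])
  qed
  then show ?thesis by (rule that)
qed

context
  fixes n :: nat and w :: "nat \<Rightarrow> 'v"
  assumes w: "orthogonal_basis n w"
begin

section \<open>Orthogonal projection in coordinates\<close>

lemma basis_vector_nonzero: "i \<in> {1..n} \<Longrightarrow> w i \<noteq> 0"
  using w dependent_zero[of "w ` {1..n}"] by (force simp: orthogonal_basis_def)

lemma basis_orthogonal: "i \<in> {1..n} \<Longrightarrow> j \<in> {1..n} \<Longrightarrow> i \<noteq> j \<Longrightarrow> ip (w i) (w j) = 0"
  using w by (simp add: orthogonal_basis_def)

lemma ip_basis_sum: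
  assumes "S \<subseteq> {1..n}" "j \<in> S"
  shows "ip (w j) (\<Sum>i\<in>S. c i *s w i) = c j * ip (w j) (w j)"
proof -
  have "finite S" using assms(1) finite_subset by blast
  have ortho: "ip (w j) (w i) = 0" if "i \<in> S" "i \<noteq> j" for i
    using basis_orthogonal assms that by blast
  have "ip (w j) (\<Sum>i\<in>S. c i *s w i) = (\<Sum>i\<in>S. if i = j then c j * ip (w j) (w j) else 0)"
    unfolding ip_sum_right
    by (rule sum.cong) (auto simp: ip_scale_right ortho)
  then show ?thesis using \<open>finite S\<close> assms(2) by simp
qed

text \<open>The residual \<open>x - ?y\<close> is orthogonal to each \<open>w j\<close> with
  \<open>j\<close> in \<open>S\<close>, hence to their span.\<close>

lemma orth_proj_span:
  assumes S: "S \<subseteq> {1..n}"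
  shows "orth_proj (span (w ` S)) x = (\<Sum>i\<in>S. (ip (w i) x / ip (w i) (w i)) *s w i)"
    (is "_ = ?y")
  unfolding orth_proj_def
proof (rule the_equality)
  have y: "?y \<in> span (w ` S)"
    by (intro span_sum span_scale span_base) auto
  have base: "ip (w j) (x - ?y) = 0" if "j \<in> S" for j
    using ip_basis_sum[OF S that] basis_vector_nonzero[of j] S that
    by (auto simp: ip_diff_right ip_self_eq_zero_iff)
  have ortho: "ip v (x - ?y) = 0" if "v \<in> span (w ` S)" for v
    using that
    by (induction v rule: span_induct_alt)
      (auto simp: ip_zero_left ip_add_left ip_scale_left base)
  show "?y \<in> span (w ` S) \<and> (\<forall>v\<in>span (w ` S). ip v (x - ?y) = 0)"
    using y ortho by blast
  fix z assume z: "z \<in> span (w ` S) \<and> (\<forall>v\<in>span (w ` S). ip v (x - z) = 0)"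
  then have d: "z - ?y \<in> span (w ` S)" using y by (simp add: span_diff)
  \<comment> \<open>The difference of the two residuals is \<open>z - ?y\<close> itself, a vector of
    the span orthogonal to the span.\<close>
  have "ip (z - ?y) ((x - ?y) - (x - z)) = 0"
    using ortho[OF d] z d by (simp only: ip_diff_right) simp
  then have "ip (z - ?y) (z - ?y) = 0" by simp
  then show "z = ?y" by (simp only: ip_self_eq_zero_iff) simp
qed

text \<open>Projecting onto the whole space is the identity; the formula for projections then gives
  the expansion.\<close>

lemma orthogonal_expansion: "(\<Sum>i\<in>{1..n}. (ip (w i) x / ip (w i) (w i)) *s w i) = x"
proof -
  have "orth_proj UNIV x = x"
    unfolding orth_proj_def
  proof (rule the_equality)
    fix y assume "y \<in> UNIV \<and> (\<forall>v\<in>UNIV. ip v (x - y) = 0)"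
    then have "ip (x - y) (x - y) = 0" by blast
    then show "y = x" by (simp add: ip_self_eq_zero_iff)
  qed (simp add: ip_zero_right)
  then show ?thesis
    using orth_proj_span[of "{1..n}" x] w by (simp add: orthogonal_basis_def)
qed

text \<open>The normalizing factors are real, so conjugation keeps them and the two square roots
  multiply to the squared length.\<close>

lemma coord_product:
  "conjugate (coord w i x) * coord w i y = conjugate (ip (w i) x) * ip (w i) y / ip (w i) (w i)"
proof -
  let ?r = "norm (ip (w i) (w i))"
  have "(1 / sqrt ?r) * (1 / sqrt ?r) = 1 / ?r" by simp
  then have "(of_real (1 / sqrt ?r) :: 'k) * of_real (1 / sqrt ?r) = of_real (1 / ?r)"
    by (simp only: flip: of_real_mult)
  also have "\<dots> = 1 / ip (w i) (w i)"
    by (simp flip: ip_self_norm)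
  finally have "(of_real (1 / sqrt ?r) :: 'k) * of_real (1 / sqrt ?r) = 1 / ip (w i) (w i)" .
  then have "conjugate (ip (w i) x) * ip (w i) y * (of_real (1 / sqrt ?r) * of_real (1 / sqrt ?r)) =
      conjugate (ip (w i) x) * ip (w i) y / ip (w i) (w i)"
    by simp
  then show ?thesis
    by (simp only: coord_def conjugate_dist_mul conjugate_of_real ac_simps)
qed

text \<open>Parseval's identity on the span. Expanding the first projection suffices: pairing with
  \<open>w i\<close> does not distinguish \<open>y\<close> from its projection.\<close>

lemma ip_orth_proj:
  assumes S: "S \<subseteq> {1..n}"
  shows "ip (orth_proj (span (w ` S)) x) (orth_proj (span (w ` S)) y) =
    (\<Sum>i\<in>S. conjugate (coord w i x) * coord w i y)"
proof -
  have "ip (w i) (orth_proj (span (w ` S)) y) = ip (w i) y" if "i \<in> S" for i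
    using ip_basis_sum[OF S that] basis_vector_nonzero[of i] S that
    by (auto simp: orth_proj_span[OF S] ip_self_eq_zero_iff)
  then have "ip (orth_proj (span (w ` S)) x) (orth_proj (span (w ` S)) y) =
      (\<Sum>i\<in>S. conjugate (ip (w i) x / ip (w i) (w i)) * ip (w i) y)"
    by (subst orth_proj_span[OF S, of x]) (simp add: ip_sum_left ip_scale_left)
  also have "\<dots> = (\<Sum>i\<in>S. conjugate (coord w i x) * coord w i y)"
  proof (rule sum.cong[OF refl])
    fix i
    have "1 / ip (w i) (w i) = of_real (1 / norm (ip (w i) (w i)))"
      by (simp flip: ip_self_norm)
    then have "conjugate (1 / ip (w i) (w i)) = 1 / ip (w i) (w i)"
      by (simp only: conjugate_of_real)
    then have "conjugate (ip (w i) x / ip (w i) (w i)) = conjugate (ip (w i) x) * (1 / ip (w i) (w i))"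
      using conjugate_dist_mul[of "ip (w i) x" "1 / ip (w i) (w i)"] by simp
    then show "conjugate (ip (w i) x / ip (w i) (w i)) * ip (w i) y =
        conjugate (coord w i x) * coord w i y"
      by (simp add: coord_product)
  qed
  finally show ?thesis .
qed

lemma ip_coord: "ip x y = (\<Sum>i = 1..n. conjugate (coord w i x) * coord w i y)"
  using ip_orth_proj[of "{1..n}" x y] orthogonal_expansion by (simp add: orth_proj_span)

section \<open>Norms of blades and of their projections\<close>

lemma det_conjugate_coord:
  "det (mat p p (\<lambda>(i, k). conjugate (coord w (I ! k) (us ! i)))) =
    conjugate (det (mat p p (\<lambda>(k, j). coord w (I ! k) (us ! j))))"
proof -
  interpret cj: comm_ring_hom "conjugate :: 'k \<Rightarrow> 'k" by (rule comm_ring_hom_conjugate)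
  have "mat p p (\<lambda>(i, k). conjugate (coord w (I ! k) (us ! i))) =
      transpose_mat (map_mat conjugate (mat p p (\<lambda>(k, j). coord w (I ! k) (us ! j))))"
    by (rule eq_matI) auto
  then show ?thesis by (simp add: det_transpose[of _ p])
qed

lemma gram_orth_proj:
  assumes I: "I \<in> multi_indices (length us) n"
  shows "gram (map (orth_proj (coord_subspace w I)) us) (map (orth_proj (coord_subspace w I)) us) =
    of_real ((norm (coord_det w I us))\<^sup>2)"
proof -
  let ?p = "length us"
  let ?A = "mat ?p ?p (\<lambda>(i, k). conjugate (coord w (I ! k) (us ! i)))"
  let ?B = "mat ?p ?p (\<lambda>(k, j). coord w (I ! k) (us ! j))"
  have S: "set I \<subseteq> {1..n}" and d: "distinct I" and len: "length I = ?p"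
    using I by (auto simp: multi_indices_def strict_sorted_iff)
  have nth: "(\<Sum>i\<in>set I. f i) = (\<Sum>k<?p. f (I ! k))" for f :: "nat \<Rightarrow> 'k"
    using sum.reindex_bij_betw[OF bij_betw_nth[OF d refl refl], of f] len by simp
  have "mat ?p ?p (\<lambda>(i, j). ip (map (orth_proj (coord_subspace w I)) us ! i)
      (map (orth_proj (coord_subspace w I)) us ! j)) = ?A * ?B"
    by (rule eq_matI)
      (auto simp: coord_subspace_def ip_orth_proj[OF S] nth scalar_prod_def atLeast0LessThan)
  then show ?thesis
    by (simp add: gram_def det_mult[of _ ?p] det_conjugate_coord coord_det_def conjugate_mult_self
        del: of_real_power)
qed

text \<open>By Parseval the Gram matrix is a product of rectangular coordinate matrices;
  Cauchy-Binet expands its determinant, each term being a minor times its conjugate.\<close>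

lemma gram_coord_det:
  "gram us us = of_real (\<Sum>I\<in>multi_indices (length us) n. (norm (coord_det w I us))\<^sup>2)"
proof -
  let ?p = "length us"
  have "gram us us =
      det (mat ?p ?p (\<lambda>(i, j). \<Sum>k = 1..n. conjugate (coord w k (us ! i)) * coord w k (us ! j)))"
    by (simp only: gram_def refl if_True flip: ip_coord)
  also have "\<dots> = (\<Sum>I\<in>multi_indices ?p n. of_real ((norm (coord_det w I us))\<^sup>2))"
    by (subst cauchy_binet[where A = "\<lambda>i k. conjugate (coord w k (us ! i))"
        and B = "\<lambda>k j. coord w k (us ! j)"])
      (simp only: det_conjugate_coord conjugate_mult_self coord_det_def)
  finally show ?thesis by (simp only: of_real_sum)
qed

lemma ext_norm_wedge:
  "ext_norm (wedge us) = sqrt (\<Sum>I\<in>multi_indices (length us) n. (norm (coord_det w I us))\<^sup>2)"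
  by (simp add: ext_norm_def ext_inner_wedge gram_coord_det sum_nonneg
      del: of_real_power of_real_sum)

text \<open>Linearity is what lets the projection act on cosets in \<open>ext_map_ext_class\<close>
  and \<open>ext_map_wedge\<close>.\<close>

lemma
  assumes I: "I \<in> multi_indices p n"
  shows orth_proj_add: "orth_proj (coord_subspace w I) (x + y) =
      orth_proj (coord_subspace w I) x + orth_proj (coord_subspace w I) y"
    and orth_proj_scale: "orth_proj (coord_subspace w I) (c *s x) =
      c *s orth_proj (coord_subspace w I) x"
proof -
  have S: "set I \<subseteq> {1..n}" using I by (simp add: multi_indices_def)
  show "orth_proj (coord_subspace w I) (x + y) =
      orth_proj (coord_subspace w I) x + orth_proj (coord_subspace w I) y"
    by (simp add: coord_subspace_def orth_proj_span[OF S] ip_add_right add_divide_distrib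
        scale_left_distrib sum.distrib)
  show "orth_proj (coord_subspace w I) (c *s x) = c *s orth_proj (coord_subspace w I) x"
    by (simp add: coord_subspace_def orth_proj_span[OF S] ip_scale_right scale_sum_right)
qed

lemma ext_norm_orth_proj_wedge:
  assumes I: "I \<in> multi_indices (length us) n"
  shows "ext_norm (ext_map (orth_proj (coord_subspace w I)) (wedge us)) = norm (coord_det w I us)"
  by (simp add: ext_norm_def ext_inner_wedge gram_orth_proj[OF I] norm_power
      ext_map_wedge[OF orth_proj_add[OF I] orth_proj_scale[OF I]])

section \<open>The Grassmann angle\<close>

text \<open>Independence of the blade: another blade scales both norms by the same factor. For
  0-blades the ratio is 1, in accordance with the empty determinant.\<close>

lemma ext_norm_ratio:
  assumes vs: "distinct vs" "independent (set vs)"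
    and I: "I \<in> multi_indices (length vs) n"
    and rep: "represents \<nu> (span (set vs))"
  shows "ext_norm (ext_map (orth_proj (coord_subspace w I)) \<nu>) / ext_norm \<nu> =
    norm (coord_det w I vs) / ext_norm (wedge vs)"
  using rep unfolding represents_def
proof (elim conjE disjE exE)
  fix c assume \<nu>: "\<nu> \<noteq> ext_class 0" "\<nu> = ext_scalar c" and "span (set vs) = {0}"
  \<comment> \<open>An independent set does not contain 0, so a basis of the zero space is
    empty.\<close>
  then have "set vs \<subseteq> {0}" using span_superset[of "set vs"] by simp
  then have "set vs = {}" using vs(2) dependent_zero[of "set vs"] by (auto dest!: subset_singletonD)
  then have "vs = []" by simp
  have "c \<noteq> 0" using \<nu> by (auto simp: ext_scalar_def)
  have "ext_norm (ext_scalar c) = norm c"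
    by (simp add: ext_norm_def ext_scalar_def ext_inner_ext_class gram_form_single_left
        gram_def \<open>c \<noteq> 0\<close> conjugate_mult_self norm_power del: of_real_power)
  moreover have "ext_map (orth_proj (coord_subspace w I)) \<nu> = \<nu>"
    by (simp add: \<nu>(2) ext_scalar_def free_map_single
        ext_map_ext_class[OF orth_proj_add[OF I] orth_proj_scale[OF I]])
  moreover have "norm (coord_det w I vs) / ext_norm (wedge vs) = 1"
    by (simp add: ext_norm_def ext_inner_wedge \<open>vs = []\<close> gram_def coord_det_def)
  ultimately show ?thesis using \<open>c \<noteq> 0\<close> \<nu>(2) by (metis divide_self norm_eq_zero)
next
  fix us assume \<nu>: "\<nu> \<noteq> ext_class 0" "\<nu> = wedge us" and span: "span (set vs) = span (set us)"
  have us: "distinct us" "independent (set us)"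
    using wedge_nonzero_imp_independent \<nu> by auto
  then have "card (set us) = card (set vs)"
    using dim_eq_card[OF span vs(2)] dim_eq_card[OF refl us(2)] by simp
  then have len: "length us = length vs"
    using us(1) vs(1) by (simp add: distinct_card)
  obtain q where q: "\<And>w I. coord_det w I us = coord_det w I vs * q"
    using coord_det_change_basis[OF len vs(1)] span span_superset[of "set us"] by auto
  have norm_us: "ext_norm (wedge us) = ext_norm (wedge vs) * norm q"
    by (simp add: ext_norm_wedge len q norm_mult power_mult_distrib real_sqrt_mult
        flip: sum_distrib_right)
  \<comment> \<open>This makes \<open>norm q\<close> nonzero, so it cancels from the ratio.\<close>
  have "ext_norm (wedge us) \<noteq> 0"
    using gram_nonzero[OF us] by (simp add: ext_norm_def ext_inner_wedge)
  then show ?thesis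
    using I by (simp add: \<nu>(2) ext_norm_orth_proj_wedge len q norm_us norm_mult)
qed

text \<open>The ratio lies between 0 and 1, because the squared minor is one term of the sum giving
  the squared norm. So \<open>arccos\<close> of it satisfies the definition of the angle.\<close>

lemma cos_grassmann_angle:
  assumes vs: "distinct vs" "independent (set vs)"
    and I: "I \<in> multi_indices (length vs) n"
  shows "cos (grassmann_angle (span (set vs)) (coord_subspace w I)) =
    norm (coord_det w I vs) / ext_norm (wedge vs)" (is "_ = ?R")
proof -
  have "norm (coord_det w I vs) \<le> ext_norm (wedge vs)"
    using member_le_sum[OF I, of "\<lambda>I. (norm (coord_det w I vs))\<^sup>2"]
    by (simp add: ext_norm_wedge finite_multi_indices real_le_rsqrt)
  moreover have "0 \<le> ext_norm (wedge vs)" by (simp add: ext_norm_def)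
  ultimately have R: "0 \<le> ?R" "?R \<le> 1"
    by (auto simp: divide_le_eq_1)
  have "grassmann_angle (span (set vs)) (coord_subspace w I) = arccos ?R"
    unfolding grassmann_angle_def
  proof (rule the_equality)
    show "0 \<le> arccos ?R \<and> arccos ?R \<le> pi / 2 \<and> (\<forall>\<nu>. represents \<nu> (span (set vs)) \<longrightarrow>
        cos (arccos ?R) = ext_norm (ext_map (orth_proj (coord_subspace w I)) \<nu>) / ext_norm \<nu>)"
      using R ext_norm_ratio[OF vs I] arccos_le_pi2[OF R] by (auto simp: arccos_lbound)
  next
    fix \<theta> assume \<theta>: "0 \<le> \<theta> \<and> \<theta> \<le> pi / 2 \<and> (\<forall>\<nu>. represents \<nu> (span (set vs)) \<longrightarrow>
        cos \<theta> = ext_norm (ext_map (orth_proj (coord_subspace w I)) \<nu>) / ext_norm \<nu>)"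
    then have "cos \<theta> = ?R"
      using represents_wedge[OF vs] ext_norm_ratio[OF vs I] by metis
    then show "\<theta> = arccos ?R" using \<theta> arccos_cos[of \<theta>] pi_gt_zero by simp
  qed
  then show ?thesis using R by simp
qed

lemma sum_cos_grassmann_angle:
  assumes V: "subspace V"
  shows "(\<Sum>I\<in>multi_indices (dim V) n. (cos (grassmann_angle V (coord_subspace w I)))\<^sup>2) = 1"
proof -
  obtain vs where vs: "distinct vs" "independent (set vs)" "span (set vs) = V" "length vs = dim V"
    using obtain_basis_list[OF V] .
  let ?N = "\<Sum>I\<in>multi_indices (dim V) n. (norm (coord_det w I vs))\<^sup>2"
  \<comment> \<open>\<open>?N\<close> is the Gram determinant of a basis, so the quotients below are
    genuine.\<close>
  have "?N \<noteq> 0"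
    using gram_nonzero[OF vs(1,2)] unfolding gram_coord_det vs(4) by fastforce
  have "(\<Sum>I\<in>multi_indices (dim V) n. (cos (grassmann_angle V (coord_subspace w I)))\<^sup>2) =
      (\<Sum>I\<in>multi_indices (dim V) n. (norm (coord_det w I vs))\<^sup>2 / ?N)"
    using cos_grassmann_angle[OF vs(1,2)] vs(3,4)
    by (simp add: power_divide ext_norm_wedge sum_nonneg)
  also have "\<dots> = 1"
    using \<open>?N \<noteq> 0\<close> by (simp flip: sum_divide_distrib)
  finally show ?thesis .
qed

end

end

theorem theorem4p4:
  fixes scale :: "'k::real_or_complex \<Rightarrow> 'v::ab_group_add \<Rightarrow> 'v"
    and ip :: "'v \<Rightarrow> 'v \<Rightarrow> 'k"
    and n p :: nat
    and V :: "'v set"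
    and w :: "nat \<Rightarrow> 'v"
  assumes X: "fin_dim_inner_space scale ip"
    and n: "vector_space.dim scale (UNIV :: 'v set) = n"
    and V: "module.subspace scale V"
    and p: "vector_space.dim scale V = p"
    and w: "fin_dim_inner_space.orthogonal_basis scale ip n w"
  shows "(\<Sum>I\<in>multi_indices p n.
           (cos (fin_dim_inner_space.grassmann_angle scale ip V
                   (fin_dim_inner_space.coord_subspace scale w I)))\<^sup>2) = 1"
proof -
  interpret fin_dim_inner_space scale ip by (rule X)
  show ?thesis using sum_cos_grassmann_angle[OF w V] p by simp
qed

end
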